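(* Let $A$ be a Witt-perfect ring and let $B$ be a $p$-torsion free $A$-algebra. Then $B$ is Witt-perfect if and only if the Frobenius map $x\mapsto x^p$ on $B/pB$ is surjective.
   Context: Fix a prime $p$. For a ring $A$, $\mathbf W_{p^n}(A)$ denotes the ring of $p$-typical Witt vectors of length $n+1$ (as a set $A^{n+1}$), and $\mathbf F:\mathbf W_{p^n}(A)\to\mathbf W_{p^{n-1}}(A)$ the Witt-Frobenius ring homomorphism. $A$ is Witt-perfect if $\mathbf F:\mathbf W_{p^n}(A)\to\mathbf W_{p^{n-1}}(A)$ is surjective for all $n\ge 2$. A ring is $p$-torsion free if $p$ is a nonzero divisor in it. *)

theory Defs
  imports "HOL-Library.Poly_Mapping" "HOL-Computational_Algebra.Primes"
begin

type_synonym zpoly = "(nat \<Rightarrow>\<^sub>0 nat) \<Rightarrow>\<^sub>0 int"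

definition zVar :: "nat \<Rightarrow> zpoly" where
  "zVar i = Poly_Mapping.single (Poly_Mapping.single i 1) 1"

definition zpoly_eval :: "(nat \<Rightarrow> 'a::comm_ring_1) \<Rightarrow> zpoly \<Rightarrow> 'a" where
  "zpoly_eval x P =
     (\<Sum>mon\<in>Poly_Mapping.keys P. of_int (Poly_Mapping.lookup P mon) *
        (\<Prod>k\<in>Poly_Mapping.keys mon. x k ^ Poly_Mapping.lookup mon k))"

definition witt_poly :: "nat \<Rightarrow> nat \<Rightarrow> zpoly" where
  "witt_poly p n = (\<Sum>i\<le>n. of_nat (p ^ i) * zVar i ^ (p ^ (n - i)))"

text \<open>Witt-Frobenius polynomials F_0, F_1, ..., determined by
  w_n(F_0,...,F_n) = w_{n+1}(X_0,...,X_{n+1}), i.e.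
  F_n = (w_{n+1}(X) - sum_{i<n} p^i F_i^(p^(n-i))) / p^n  (exact division in Z[X]).
  frob_polys p n is the list [F_0, ..., F_{n-1}].\<close>
primrec frob_polys :: "nat \<Rightarrow> nat \<Rightarrow> zpoly list" where
  "frob_polys p 0 = []"
| "frob_polys p (Suc n) = frob_polys p n @
     [Poly_Mapping.map (\<lambda>c. c div (int p ^ n))
        (witt_poly p (Suc n) -
         (\<Sum>i<n. of_nat (p ^ i) * (frob_polys p n ! i) ^ (p ^ (n - i))))]"

definition witt_frob_poly :: "nat \<Rightarrow> nat \<Rightarrow> zpoly" where
  "witt_frob_poly p n = frob_polys p (Suc n) ! n"

text \<open>The Witt-Frobenius F : W_{p^n}(A) -> W_{p^(n-1)}(A); a Witt vector of
  length n+1 is represented by a function x with meaningful entries x_0..x_n.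
  The i-th component of F(x) (i < n) is F_i(x_0,...,x_{i+1}).\<close>
definition witt_frobenius :: "nat \<Rightarrow> nat \<Rightarrow> (nat \<Rightarrow> 'a::comm_ring_1) \<Rightarrow> (nat \<Rightarrow> 'a)" where
  "witt_frobenius p n x = (\<lambda>i. if i < n then zpoly_eval x (witt_frob_poly p i) else 0)"

definition witt_perfect :: "nat \<Rightarrow> 'a::comm_ring_1 itself \<Rightarrow> bool" where
  "witt_perfect p _ \<longleftrightarrow>
     (\<forall>n\<ge>2. \<forall>y :: nat \<Rightarrow> 'a. \<exists>x :: nat \<Rightarrow> 'a.
        \<forall>i<n. witt_frobenius p n (\<lambda>j. if j \<le> n then x j else 0) i = y i)"

definition p_torsion_free :: "nat \<Rightarrow> 'a::comm_ring_1 itself \<Rightarrow> bool" where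
  "p_torsion_free p _ \<longleftrightarrow> (\<forall>b :: 'a. of_nat p * b = 0 \<longrightarrow> b = 0)"

end

theory Submission
  imports Defs
begin

text \<open>In terms of ghost components, the Witt-Frobenius is the shift g \<mapsto> (g(1), g(2), ...), and over a
  p-torsion free ring a Witt vector is determined by its ghost components. By Dwork's criterion over
  Z[X_0, X_1, ...], the ghost sequences form a subring W of the sequences, closed under the shift;
  this holds over every ring by specialisation.

  Surjectivity modulo p lifts to length n + 1 by induction on n: it suffices to reach, by some h in W
  with h(1) = ... = h(n) = 0, every last ghost component h(n+1) = p^n b. Applying the induction
  hypothesis twice to the Witt vector with the single component b in place n - 1 gives c in W with
  c(2) = ... = c(n) = 0 and c(n+1) = p^(n-1) b modulo p^n. Multiplying c by an element tau of W with
  tau(1) = 0 and tau(m) = p modulo p^2 for m \<ge> 2 gives h, up to a multiple of p^(n+1) that is the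
  ghost component of a single coordinate. The element tau is all that is needed from A: if
  F(x_0, x_1, x_2) = (0, 1) in A, then x_0^p = - p x_1 and x_1^p = 1 modulo p in B, and tau is given
  by (x_0, x_1, 0, 0, ...).\<close>

section \<open>Congruences and ring homomorphisms\<close>

lemma dvd_diff_mult_mult:
  fixes m :: "'a::comm_ring_1"
  assumes "m dvd a - b" and "m dvd c - d"
  shows "m dvd a * c - b * d"
proof -
  have "a * c - b * d = (a - b) * c + b * (c - d)"
    by (simp add: algebra_simps)
  then show ?thesis
    using assms by simp
qed

lemma dvd_diff_power_power:
  fixes m :: "'a::comm_ring_1"
  assumes "m dvd a - b"
  shows "m dvd a ^ n - b ^ n"
  using assms by (simp add: power_diff_sumr2)

lemma prime_dvd_binomial_expansion:
  fixes a b :: "'a::comm_ring_1"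
  assumes "prime p"
  shows "of_nat p dvd (a + b) ^ p - (a ^ p + b ^ p)"
proof -
  have p: "p > 0"
    using assms by (simp add: prime_gt_0_nat)
  let ?t = "\<lambda>k. of_nat (p choose k) * a ^ k * b ^ (p - k)"
  have "(a + b) ^ p = (\<Sum>k\<in>{..p} - {0, p}. ?t k) + (\<Sum>k\<in>{0, p}. ?t k)"
    unfolding binomial_ring by (rule sum.subset_diff) auto
  also have "(\<Sum>k\<in>{0, p}. ?t k) = a ^ p + b ^ p"
    using p by (simp add: add.commute)
  finally have "(a + b) ^ p - (a ^ p + b ^ p) = (\<Sum>k\<in>{..p} - {0, p}. ?t k)"
    by simp
  moreover have "of_nat p dvd ?t k" if "k \<in> {..p} - {0, p}" for k
  proof -
    have "p dvd p choose k"
      using that p assms by (intro dvd_choose_prime) auto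
    then show ?thesis
      by (metis dvd_def dvd_mult2 of_nat_mult)
  qed
  ultimately show ?thesis
    by (simp only: dvd_sum)
qed

text \<open>In \<open>a ^ p - b ^ p = (a - b) * ?S\<close> the factor \<open>?S\<close> has p terms,
  all congruent to \<open>b ^ (p - 1)\<close> modulo p, so it supplies one further factor p.\<close>

lemma dvd_power_prime_lift:
  fixes a b :: "'a::comm_ring_1"
  assumes "of_nat p ^ Suc j dvd a - b"
  shows "of_nat p ^ Suc (Suc j) dvd a ^ p - b ^ p"
proof -
  let ?S = "\<Sum>i<p. b ^ (p - Suc i) * a ^ i"
  have ab: "of_nat p dvd a - b"
    using assms by (meson dvd_power dvd_trans zero_less_Suc)
  have "of_nat p dvd (\<Sum>i<p. b ^ (p - Suc i) * (a ^ i - b ^ i))"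
    by (intro dvd_sum dvd_mult dvd_diff_power_power ab)
  also have "(\<Sum>i<p. b ^ (p - Suc i) * (a ^ i - b ^ i)) = ?S - (\<Sum>i<p. b ^ (p - 1))"
    by (simp add: right_diff_distrib sum_subtractf flip: power_add)
  finally have "of_nat p dvd ?S"
    by (simp add: dvd_diff_left_iff)
  then have "of_nat p ^ Suc j * of_nat p dvd (a - b) * ?S"
    using assms by (rule mult_dvd_mono[rotated])
  then show ?thesis
    by (simp add: power_diff_sumr2 mult.commute)
qed

lemma dvd_power_prime_power_lift:
  fixes a b :: "'a::comm_ring_1"
  assumes "of_nat p dvd a - b"
  shows "of_nat p ^ Suc k dvd a ^ (p ^ k) - b ^ (p ^ k)"
proof (induction k)
  case (Suc k)
  from dvd_power_prime_lift[OF this] show ?case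
    by (simp add: mult.commute flip: power_mult)
qed (use assms in simp)

locale comm_ring_hom =
  fixes h :: "'a::comm_ring_1 \<Rightarrow> 'b::comm_ring_1"
  assumes hom_one: "h 1 = 1"
    and hom_add: "h (x + y) = h x + h y"
    and hom_mult: "h (x * y) = h x * h y"
begin

lemma hom_zero: "h 0 = 0"
  using hom_add[of 0 0] by simp

lemma hom_diff: "h (x - y) = h x - h y"
  using hom_add[of "x - y" y] by (simp add: algebra_simps)

lemma hom_of_nat: "h (of_nat n) = of_nat n"
  by (induction n) (simp_all add: hom_zero hom_one hom_add)

lemma hom_power: "h (x ^ n) = h x ^ n"
  by (induction n) (simp_all add: hom_one hom_mult)

lemma hom_sum: "h (sum g I) = (\<Sum>i\<in>I. h (g i))"
  by (induction I rule: infinite_finite_induct) (simp_all add: hom_zero hom_add)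

end

section \<open>Evaluation of integer polynomials\<close>

definition mon_eval :: "(nat \<Rightarrow> 'a::comm_ring_1) \<Rightarrow> (nat \<Rightarrow>\<^sub>0 nat) \<Rightarrow> 'a" where
  "mon_eval x m = (\<Prod>k\<in>Poly_Mapping.keys m. x k ^ Poly_Mapping.lookup m k)"

lemma mon_eval_superset:
  assumes "finite S" and "Poly_Mapping.keys m \<subseteq> S"
  shows "mon_eval x m = (\<Prod>k\<in>S. x k ^ Poly_Mapping.lookup m k)"
  unfolding mon_eval_def using assms
  by (intro prod.mono_neutral_left) (auto simp: in_keys_iff)

lemma mon_eval_add: "mon_eval x (m + m') = mon_eval x m * mon_eval x m'"
proof -
  let ?S = "Poly_Mapping.keys m \<union> Poly_Mapping.keys m'"
  have "mon_eval x (m + m') = (\<Prod>k\<in>?S. x k ^ Poly_Mapping.lookup (m + m') k)"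
    using keys_add[of m m'] by (intro mon_eval_superset) auto
  then show ?thesis
    by (simp add: mon_eval_superset[of ?S] lookup_add power_add prod.distrib)
qed

lemma zpoly_eval_add: "zpoly_eval x (P + Q) = zpoly_eval x P + zpoly_eval x Q"
  unfolding zpoly_eval_def
  by (rule setsum_keys_plus_distrib) (simp_all add: algebra_simps)

lemma zpoly_eval_single: "zpoly_eval x (Poly_Mapping.single m c) = of_int c * mon_eval x m"
  by (simp add: zpoly_eval_def mon_eval_def)

lemma zpoly_eval_diff: "zpoly_eval x (P - Q) = zpoly_eval x P - zpoly_eval x Q"
  using zpoly_eval_add[of x "P - Q" Q] by (simp add: algebra_simps)

text \<open>Monomials with coefficient 1 generate the additive group of polynomials, and closure
  under differences covers all integer coefficients.\<close>

lemma zpoly_induct [case_names zero monomial diff]: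
  fixes P :: zpoly
  assumes "R 0" and "\<And>m. R (Poly_Mapping.single m 1)" and "\<And>P Q. R P \<Longrightarrow> R Q \<Longrightarrow> R (P - Q)"
  shows "R P"
  using frag_induction[of P UNIV R] assms by auto

lemma zpoly_eval_mult_monomial:
  "zpoly_eval x (P * Poly_Mapping.single m 1) = zpoly_eval x P * mon_eval x m"
proof (induction P rule: zpoly_induct)
  case zero
  then show ?case by (simp add: zpoly_eval_def)
next
  case (monomial m)
  then show ?case by (simp add: mult_single zpoly_eval_single mon_eval_add)
next
  case (diff P Q)
  then show ?case by (simp add: left_diff_distrib zpoly_eval_diff)
qed

lemma zpoly_eval_mult: "zpoly_eval x (P * Q) = zpoly_eval x P * zpoly_eval x Q"
proof (induction Q rule: zpoly_induct)
  case zero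
  then show ?case by (simp add: zpoly_eval_def)
next
  case (monomial m)
  then show ?case by (simp add: zpoly_eval_mult_monomial zpoly_eval_single)
next
  case (diff P Q)
  then show ?case by (simp add: right_diff_distrib zpoly_eval_diff)
qed

lemma comm_ring_hom_zpoly_eval: "comm_ring_hom (zpoly_eval x)"
proof
  show "zpoly_eval x 1 = 1"
    using zpoly_eval_single[of x 0 1] by (simp add: mon_eval_def)
qed (simp_all add: zpoly_eval_add zpoly_eval_mult)

lemma zpoly_eval_zVar: "zpoly_eval x (zVar i) = x i"
  by (simp add: zVar_def zpoly_eval_single mon_eval_def)

lemma monomial_eq_prod_zVar: "Poly_Mapping.single m 1 = mon_eval zVar m"
proof (induction m rule: update_induct)
  case const
  then show ?case by (simp add: mon_eval_def)
next
  case (update m a b)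
  have "zVar a ^ n = Poly_Mapping.single (Poly_Mapping.single a n) 1" for n
    by (induction n) (simp_all add: zVar_def mult_single flip: single_add)
  then have "mon_eval zVar (Poly_Mapping.single a b) = Poly_Mapping.single (Poly_Mapping.single a b) 1"
    using update by (simp add: mon_eval_def)
  moreover have "Poly_Mapping.update a b m = m + Poly_Mapping.single a b"
    using update by (intro poly_mapping_eqI) (auto simp: lookup_update lookup_add lookup_single in_keys_iff when_def)
  ultimately show ?case
    using update by (simp add: mon_eval_add mult_single flip: update(3))
qed

section \<open>The Frobenius lift on Z[X_0, X_1, ...]\<close>

definition frob_lift :: "nat \<Rightarrow> zpoly \<Rightarrow> zpoly" where
  "frob_lift p = zpoly_eval (\<lambda>i. zVar i ^ p)"

lemma comm_ring_hom_frob_lift: "comm_ring_hom (frob_lift p)"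
  unfolding frob_lift_def by (rule comm_ring_hom_zpoly_eval)

text \<open>On monomials both sides agree exactly, and the p-th power is additive modulo p.\<close>

lemma frob_lift_cong:
  assumes "prime p"
  shows "of_nat p dvd frob_lift p P - P ^ p"
proof (induction P rule: zpoly_induct)
  case zero
  then show ?case
    using prime_gt_0_nat[OF assms]
    by (simp add: comm_ring_hom.hom_zero[OF comm_ring_hom_frob_lift] power_0_left)
next
  case (monomial m)
  have "frob_lift p (Poly_Mapping.single m 1) = Poly_Mapping.single m 1 ^ p"
    unfolding frob_lift_def zpoly_eval_single
    by (simp add: monomial_eq_prod_zVar mon_eval_def prod_power_distrib mult.commute flip: power_mult)
  then show ?case by simp
next
  case (diff P Q)
  \<comment> \<open>Expanding P as (P - Q) + Q avoids the sign of \<open>(- Q) ^ p\<close>, which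
    depends on the parity of p.\<close>
  have "of_nat p dvd (P - Q + Q) ^ p - ((P - Q) ^ p + Q ^ p)"
    by (rule prime_dvd_binomial_expansion[OF assms])
  then have "of_nat p dvd P ^ p - ((P - Q) ^ p + Q ^ p)"
    by simp
  with dvd_diff[OF diff]
  have "of_nat p dvd (frob_lift p P - P ^ p) - (frob_lift p Q - Q ^ p) + (P ^ p - ((P - Q) ^ p + Q ^ p))"
    by (rule dvd_add)
  also have "\<dots> = frob_lift p (P - Q) - (P - Q) ^ p"
    by (simp add: comm_ring_hom.hom_diff[OF comm_ring_hom_frob_lift])
  finally show ?case .
qed

section \<open>Ghost components and Dwork's criterion\<close>

text \<open>The value of the Witt polynomial w_n at x. Taking infinite Witt vectors over any ring
  lets truncation appear only as a bound on indices.\<close>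

definition ghost :: "nat \<Rightarrow> (nat \<Rightarrow> 'a::comm_ring_1) \<Rightarrow> nat \<Rightarrow> 'a" where
  "ghost p x n = (\<Sum>i\<le>n. of_nat p ^ i * x i ^ (p ^ (n - i)))"

lemma (in comm_ring_hom) hom_ghost: "h (ghost p x n) = ghost p (\<lambda>i. h (x i)) n"
  by (simp add: ghost_def hom_sum hom_mult hom_power hom_of_nat)

lemma ghost_cong: "(\<And>i. i \<le> n \<Longrightarrow> x i = y i) \<Longrightarrow> ghost p x n = ghost p y n"
  by (simp add: ghost_def)

lemma ghost_split_top:
  "ghost p x n = (\<Sum>i<n. of_nat p ^ i * x i ^ (p ^ (n - i))) + of_nat p ^ n * x n"
  by (simp add: ghost_def flip: lessThan_Suc_atMost)

definition dwork :: "nat \<Rightarrow> (nat \<Rightarrow> zpoly) \<Rightarrow> bool" where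
  "dwork p g \<longleftrightarrow> (\<forall>n. of_nat p ^ Suc n dvd g (Suc n) - frob_lift p (g n))"

text \<open>The lift of z_i is z_i^p modulo p; raising to the power p^(n-i) improves this to modulo
  p^(n-i+1), and the coefficient p^i completes p^(n+1). Omitting the top term of the ghost sum lets
  the lemma serve both directions of Dwork's criterion.\<close>

lemma dvd_partial_ghost_diff_frob_lift:
  assumes "prime p"
  shows "of_nat p ^ Suc n dvd (\<Sum>i<Suc n. of_nat p ^ i * z i ^ (p ^ (Suc n - i))) - frob_lift p (ghost p z n)"
proof -
  interpret phi: comm_ring_hom "frob_lift p"
    by (rule comm_ring_hom_frob_lift)
  have "of_nat p ^ Suc n dvd of_nat p ^ i * z i ^ (p ^ (Suc n - i)) - of_nat p ^ i * frob_lift p (z i) ^ (p ^ (n - i))"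
    if "i \<le> n" for i
  proof -
    have "of_nat p ^ Suc (n - i) dvd (z i ^ p) ^ (p ^ (n - i)) - frob_lift p (z i) ^ (p ^ (n - i))"
      using frob_lift_cong[OF assms, of "z i"]
      by (intro dvd_power_prime_power_lift) (metis dvd_minus_iff minus_diff_eq)
    then have "of_nat p ^ i * of_nat p ^ Suc (n - i) dvd
        of_nat p ^ i * ((z i ^ p) ^ (p ^ (n - i)) - frob_lift p (z i) ^ (p ^ (n - i)))"
      by (rule mult_dvd_mono[OF dvd_refl])
    moreover have "i + Suc (n - i) = Suc n"
      using that by simp
    ultimately show ?thesis
      using that by (simp only: flip: power_add)
        (simp add: right_diff_distrib Suc_diff_le flip: power_mult)
  qed
  then have "of_nat p ^ Suc n dvd (\<Sum>i\<le>n. of_nat p ^ i * z i ^ (p ^ (Suc n - i)) - of_nat p ^ i * frob_lift p (z i) ^ (p ^ (n - i)))"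
    by (intro dvd_sum) simp
  then show ?thesis
    by (simp only: ghost_def sum_subtractf phi.hom_sum phi.hom_mult phi.hom_power phi.hom_of_nat lessThan_Suc_atMost)
qed

lemma dwork_ghost:
  assumes "prime p"
  shows "dwork p (ghost p z)"
  unfolding dwork_def
proof
  fix n
  have "of_nat p ^ Suc n dvd
      (\<Sum>i<Suc n. of_nat p ^ i * z i ^ (p ^ (Suc n - i))) - frob_lift p (ghost p z n) + of_nat p ^ Suc n * z (Suc n)"
    by (intro dvd_add dvd_partial_ghost_diff_frob_lift[OF assms]) simp
  then show "of_nat p ^ Suc n dvd ghost p z (Suc n) - frob_lift p (ghost p z n)"
    by (simp only: ghost_split_top[of p z "Suc n"] diff_add_eq)
qed

text \<open>The choice is meaningful only for sequences satisfying Dwork's criterion.\<close>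

fun unghost :: "nat \<Rightarrow> (nat \<Rightarrow> zpoly) \<Rightarrow> nat \<Rightarrow> zpoly" where
  "unghost p g n = (SOME w. g n = (\<Sum>i<n. of_nat p ^ i * unghost p g i ^ (p ^ (n - i))) + of_nat p ^ n * w)"

declare unghost.simps [simp del]

text \<open>The harder half of Dwork's criterion: components are solved for one at a time, since the
  partial ghost sum and \<open>g (Suc n)\<close> are both congruent to the lift of
  \<open>g n\<close>.\<close>

lemma ghost_unghost:
  assumes "prime p" and "dwork p g"
  shows "ghost p (unghost p g) = g"
proof
  fix n
  have "ghost p (unghost p g) n = g n"
    if "\<exists>w. g n = (\<Sum>i<n. of_nat p ^ i * unghost p g i ^ (p ^ (n - i))) + of_nat p ^ n * w" for n
    using someI_ex[OF that] by (simp add: ghost_split_top flip: unghost.simps)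
  moreover have "\<exists>w. g n = (\<Sum>i<n. of_nat p ^ i * unghost p g i ^ (p ^ (n - i))) + of_nat p ^ n * w" for n
  proof (induction n)
    case (Suc n)
    let ?S = "\<Sum>i<Suc n. of_nat p ^ i * unghost p g i ^ (p ^ (Suc n - i))"
    have "ghost p (unghost p g) n = g n"
      using Suc by (rule calculation)
    then have "of_nat p ^ Suc n dvd ?S - frob_lift p (g n)"
      using dvd_partial_ghost_diff_frob_lift[OF assms(1), of n "unghost p g"] by simp
    moreover have "of_nat p ^ Suc n dvd g (Suc n) - frob_lift p (g n)"
      using assms(2) by (simp add: dwork_def)
    ultimately have "of_nat p ^ Suc n dvd (g (Suc n) - frob_lift p (g n)) - (?S - frob_lift p (g n))"
      by (rule dvd_diff[rotated])
    then have "of_nat p ^ Suc n dvd g (Suc n) - ?S"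
      by (simp only: diff_diff_eq2 diff_add_cancel)
    then obtain w where "g (Suc n) - ?S = of_nat p ^ Suc n * w" ..
    then show ?case
      by (intro exI[of _ w]) (simp only: diff_eq_eq add.commute)
  qed simp
  ultimately show "ghost p (unghost p g) n = g n"
    by blast
qed

lemma ghost_range_zpoly_eval:
  assumes "prime p" and "dwork p G"
  shows "(\<lambda>n. zpoly_eval v (G n)) \<in> range (ghost p)"
proof -
  interpret ev: comm_ring_hom "zpoly_eval v"
    by (rule comm_ring_hom_zpoly_eval)
  have "(\<lambda>n. zpoly_eval v (G n)) = ghost p (\<lambda>i. zpoly_eval v (unghost p G i))"
    by (subst ghost_unghost[OF assms, symmetric]) (simp add: ev.hom_ghost fun_eq_iff)
  then show ?thesis by blast
qed

lemma dwork_diff: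
  assumes "dwork p g" and "dwork p h"
  shows "dwork p (\<lambda>n. g n - h n)"
  unfolding dwork_def
proof
  fix n
  have "of_nat p ^ Suc n dvd (g (Suc n) - frob_lift p (g n)) - (h (Suc n) - frob_lift p (h n))"
    using assms unfolding dwork_def by (blast intro: dvd_diff)
  then show "of_nat p ^ Suc n dvd g (Suc n) - h (Suc n) - frob_lift p (g n - h n)"
    by (simp add: comm_ring_hom.hom_diff[OF comm_ring_hom_frob_lift] algebra_simps)
qed

lemma dwork_mult:
  assumes "dwork p g" and "dwork p h"
  shows "dwork p (\<lambda>n. g n * h n)"
  using assms unfolding dwork_def comm_ring_hom.hom_mult[OF comm_ring_hom_frob_lift]
  by (blast intro: dvd_diff_mult_mult)

section \<open>Ring operations and the shift on ghost sequences\<close>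

context
  fixes p :: nat
  assumes p: "prime p"
begin

text \<open>A general ring carries no Frobenius lift, so a pair of ghost sequences is exhibited as a
  specialisation of a pair over Z[X_0, X_1, ...], where Dwork's criterion is available.\<close>

lemma ghost_range_universal:
  fixes g h :: "nat \<Rightarrow> 'a::comm_ring_1"
  assumes "g \<in> range (ghost p)" and "h \<in> range (ghost p)"
  obtains v G H where "dwork p G" and "dwork p H"
    and "\<And>n. g n = zpoly_eval v (G n)" and "\<And>n. h n = zpoly_eval v (H n)"
proof -
  obtain x y where x: "g = ghost p x" and y: "h = ghost p y"
    using assms by blast
  \<comment> \<open>The even variables carry the components of x, the odd ones those of y.\<close>
  define v where "v = (\<lambda>k. if even k then x (k div 2) else y (k div 2))"
  interpret ev: comm_ring_hom "zpoly_eval v"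
    by (rule comm_ring_hom_zpoly_eval)
  show thesis
  proof
    show "g n = zpoly_eval v (ghost p (\<lambda>i. zVar (2 * i)) n)" for n
      unfolding ev.hom_ghost by (simp add: zpoly_eval_zVar x v_def)
    show "h n = zpoly_eval v (ghost p (\<lambda>i. zVar (Suc (2 * i))) n)" for n
      unfolding ev.hom_ghost by (simp add: zpoly_eval_zVar y v_def)
  qed (rule dwork_ghost[OF p])+
qed

lemma ghost_range_diff:
  fixes g h :: "nat \<Rightarrow> 'a::comm_ring_1"
  assumes "g \<in> range (ghost p)" and "h \<in> range (ghost p)"
  shows "(\<lambda>n. g n - h n) \<in> range (ghost p)"
proof (rule ghost_range_universal[OF assms])
  fix v G H
  assume "dwork p G" "dwork p H" "\<And>n. g n = zpoly_eval v (G n)" "\<And>n. h n = zpoly_eval v (H n)"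
  then show ?thesis
    using ghost_range_zpoly_eval[OF p dwork_diff, of G H v] by (simp add: zpoly_eval_diff)
qed

lemma ghost_range_mult:
  fixes g h :: "nat \<Rightarrow> 'a::comm_ring_1"
  assumes "g \<in> range (ghost p)" and "h \<in> range (ghost p)"
  shows "(\<lambda>n. g n * h n) \<in> range (ghost p)"
proof (rule ghost_range_universal[OF assms])
  fix v G H
  assume "dwork p G" "dwork p H" "\<And>n. g n = zpoly_eval v (G n)" "\<And>n. h n = zpoly_eval v (H n)"
  then show ?thesis
    using ghost_range_zpoly_eval[OF p dwork_mult, of G H v] by (simp add: zpoly_eval_mult)
qed

lemma ghost_range_add:
  fixes g h :: "nat \<Rightarrow> 'a::comm_ring_1"
  assumes "g \<in> range (ghost p)" and "h \<in> range (ghost p)"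
  shows "(\<lambda>n. g n + h n) \<in> range (ghost p)"
proof -
  \<comment> \<open>The zero sequence, so that the sum becomes g - (0 - h).\<close>
  have "(\<lambda>n. h n - h n) \<in> range (ghost p)"
    by (rule ghost_range_diff[OF assms(2) assms(2)])
  from ghost_range_diff[OF assms(1) ghost_range_diff[OF this assms(2)]] show ?thesis
    by simp
qed

lemma dwork_shift_ghost: "dwork p (\<lambda>n. ghost p z (Suc n))"
  unfolding dwork_def
proof
  fix n
  have "(of_nat p :: zpoly) ^ Suc n dvd of_nat p ^ Suc (Suc n)"
    by (rule le_imp_power_dvd) simp
  also have "\<dots> dvd ghost p z (Suc (Suc n)) - frob_lift p (ghost p z (Suc n))"
    using dwork_ghost[OF p, of z] unfolding dwork_def by (rule spec)
  finally show "of_nat p ^ Suc n dvd ghost p z (Suc (Suc n)) - frob_lift p (ghost p z (Suc n))" .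
qed

section \<open>The Witt-Frobenius polynomials\<close>

lemma witt_poly_eq_ghost: "witt_poly p n = ghost p zVar n"
  by (simp add: witt_poly_def ghost_def)

lemma map_div_of_nat_mult:
  fixes P :: zpoly
  assumes "k > 0"
  shows "Poly_Mapping.map (\<lambda>c. c div int k) (of_nat k * P) = P"
proof -
  have "of_nat k * P = Poly_Mapping.map ((*) (int k)) P"
    by (simp add: mult_map_scale_conv_mult)
  then show ?thesis
    using assms by (intro poly_mapping_eqI) (simp add: map.rep_eq when_def)
qed

text \<open>The recursion solves the equation that defines \<open>unghost\<close> for the shifted
  universal ghost sequence. Dwork's criterion makes the coefficientwise \<open>div\<close>
  exact.\<close>

lemma frob_polys_eq: "frob_polys p n = map (unghost p (\<lambda>n. ghost p zVar (Suc n))) [0..<n]"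
proof (induction n)
  case (Suc n)
  let ?Z = "unghost p (\<lambda>n. ghost p zVar (Suc n))"
  have "ghost p zVar (Suc n) = ghost p ?Z n"
    by (simp add: ghost_unghost[OF p dwork_shift_ghost])
  then have "witt_poly p (Suc n) - (\<Sum>i<n. of_nat (p ^ i) * ?Z i ^ (p ^ (n - i))) = of_nat (p ^ n) * ?Z n"
    by (simp add: witt_poly_eq_ghost ghost_split_top[of p ?Z])
  moreover have "(\<Sum>i<n. of_nat (p ^ i) * (frob_polys p n ! i) ^ (p ^ (n - i))) = (\<Sum>i<n. of_nat (p ^ i) * ?Z i ^ (p ^ (n - i)))"
    by (simp add: Suc)
  ultimately show ?case
    using map_div_of_nat_mult[of "p ^ n" "?Z n"] prime_gt_0_nat[OF p] Suc by simp
qed simp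

lemma ghost_witt_frob_poly: "ghost p (\<lambda>i. zpoly_eval x (witt_frob_poly p i)) n = ghost p x (Suc n)"
proof -
  interpret ev: comm_ring_hom "zpoly_eval x"
    by (rule comm_ring_hom_zpoly_eval)
  have "witt_frob_poly p = unghost p (\<lambda>n. ghost p zVar (Suc n))"
    by (simp add: witt_frob_poly_def frob_polys_eq fun_eq_iff del: upt_Suc frob_polys.simps)
  then have "ghost p (witt_frob_poly p) n = ghost p zVar (Suc n)"
    by (simp add: ghost_unghost[OF p dwork_shift_ghost])
  then have "zpoly_eval x (ghost p (witt_frob_poly p) n) = zpoly_eval x (ghost p zVar (Suc n))"
    by simp
  then show ?thesis
    by (simp add: ev.hom_ghost zpoly_eval_zVar)
qed

lemma ghost_range_shift:
  fixes g :: "nat \<Rightarrow> 'a::comm_ring_1"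
  assumes "g \<in> range (ghost p)"
  shows "(\<lambda>n. g (Suc n)) \<in> range (ghost p)"
proof -
  obtain x where x: "g = ghost p x"
    using assms by blast
  have "(\<lambda>n. g (Suc n)) = ghost p (\<lambda>i. zpoly_eval x (witt_frob_poly p i))"
    by (simp add: fun_eq_iff ghost_witt_frob_poly x)
  then show ?thesis by blast
qed

end

section \<open>Torsion-free rings\<close>

lemma p_torsion_free_power_cancel:
  fixes b c :: "'b::comm_ring_1"
  assumes "p_torsion_free p TYPE('b)" and "of_nat p ^ n * b = of_nat p ^ n * c"
  shows "b = c"
  using assms(2)
proof (induction n)
  case (Suc n)
  then have "of_nat p * (of_nat p ^ n * b - of_nat p ^ n * c) = 0"
    by (simp add: algebra_simps)
  then have "of_nat p ^ n * b - of_nat p ^ n * c = 0"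
    using assms(1) unfolding p_torsion_free_def by blast
  then show ?case
    using Suc.IH by simp
qed simp

text \<open>Component i enters ghost component i linearly, as \<open>of_nat p ^ i * x i\<close>, and
  the power of p cancels.\<close>

lemma ghost_inj_upto:
  fixes x y :: "nat \<Rightarrow> 'b::comm_ring_1"
  assumes "p_torsion_free p TYPE('b)" and "\<And>k. k < n \<Longrightarrow> ghost p x k = ghost p y k" and "i < n"
  shows "x i = y i"
  using assms(3)
proof (induction i rule: less_induct)
  case (less i)
  then have "(\<Sum>j<i. of_nat p ^ j * x j ^ (p ^ (i - j))) = (\<Sum>j<i. of_nat p ^ j * y j ^ (p ^ (i - j)))"
    by simp
  then have "of_nat p ^ i * x i = of_nat p ^ i * y i"
    using assms(2)[OF less.prems] by (simp add: ghost_split_top)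
  then show ?case
    by (rule p_torsion_free_power_cancel[OF assms(1)])
qed

text \<open>The Witt vector V^n [b], with V the Verschiebung and [b] the Teichmueller
  representative.\<close>

definition single_comp :: "nat \<Rightarrow> 'a::zero \<Rightarrow> nat \<Rightarrow> 'a" where
  "single_comp n b = (\<lambda>i. if i = n then b else 0)"

lemma ghost_single_comp_below:
  assumes "p > 0" and "k < n"
  shows "ghost p (single_comp n b) k = 0"
  using assms by (auto simp: ghost_def single_comp_def power_0_left intro!: sum.neutral)

lemma ghost_single_comp_top:
  assumes "p > 0"
  shows "ghost p (single_comp n b) n = of_nat p ^ n * b"
proof -
  have "(\<Sum>i<n. of_nat p ^ i * single_comp n b i ^ (p ^ (n - i))) = 0"
    using assms by (intro sum.neutral) (auto simp: single_comp_def power_0_left)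
  then show ?thesis
    by (simp add: ghost_split_top single_comp_def)
qed

lemma ghost_range_leading:
  fixes g :: "nat \<Rightarrow> 'b::comm_ring_1"
  assumes "p > 0" and tf: "p_torsion_free p TYPE('b)"
    and "g \<in> range (ghost p)" and "\<And>k. k < n \<Longrightarrow> g k = 0"
  obtains b where "g n = of_nat p ^ n * b"
proof -
  obtain x where x: "g = ghost p x"
    using assms by blast
  \<comment> \<open>\<open>single_comp n 0\<close> is the zero vector, so the leading components of
    x vanish.\<close>
  have "x i = single_comp n 0 i" if "i < n" for i
  proof (rule ghost_inj_upto[OF tf _ that])
    fix k
    assume "k < n"
    then show "ghost p x k = ghost p (single_comp n 0) k"
      using assms(4)[of k] by (simp add: x ghost_single_comp_below[OF assms(1)])
  qed
  then have "g n = of_nat p ^ n * x n"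
    using assms(1) by (simp add: x ghost_split_top single_comp_def power_0_left)
  then show thesis ..
qed

text \<open>A lift for n entries misses entry n by a multiple of p^n, by
  \<open>ghost_range_leading\<close>; \<open>top\<close> removes this error without disturbing the
  earlier entries.\<close>

lemma ghost_frobenius_surj:
  fixes g \<tau> :: "nat \<Rightarrow> 'b::comm_ring_1"
  assumes p: "prime p" and tf: "p_torsion_free p TYPE('b)"
    and frob: "\<And>b :: 'b. \<exists>c d. b = c ^ p + of_nat p * d"
    and tau: "\<tau> \<in> range (ghost p)" "\<tau> 1 = 0" "\<And>m. m \<ge> 2 \<Longrightarrow> \<exists>s. \<tau> m = of_nat p * (1 + of_nat p * s)"
  shows "g \<in> range (ghost p) \<Longrightarrow> \<exists>h\<in>range (ghost p). \<forall>k<n. h (Suc k) = g k"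
proof (induction n arbitrary: g)
  case 0
  then show ?case by blast
next
  case (Suc n)
  note p_pos = prime_gt_0_nat[OF p]
  have top: "\<exists>h\<in>range (ghost p). (\<forall>k<n. h (Suc k) = 0) \<and> h (Suc n) = of_nat p ^ n * b" for b :: 'b
  proof (cases n)
    case 0
    \<comment> \<open>The base case is exactly surjectivity of Frobenius modulo p: ghost component 1
      is \<open>c ^ p + of_nat p * d\<close>.\<close>
    obtain c d where "b = c ^ p + of_nat p * d"
      using frob by blast
    then have "ghost p (\<lambda>i. if i = 0 then c else d) (Suc n) = of_nat p ^ n * b"
      using 0 by (simp add: ghost_def)
    then show ?thesis
      using 0 by blast
  next
    case n: (Suc m)
    \<comment> \<open>With n = m + 1, the entries a(1), ..., a(m) vanish and a(n) = p^m b. Lifting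
      once more moves these one place up; c(1) = a(0) stays unknown, and c(n+1) equals a(n) only
      modulo p^n.\<close>
    obtain a where a: "a \<in> range (ghost p)" "\<And>k. k < n \<Longrightarrow> a (Suc k) = ghost p (single_comp m b) k"
      using Suc.IH[of "ghost p (single_comp m b)"] by blast
    obtain c where c: "c \<in> range (ghost p)" "\<And>k. k < n \<Longrightarrow> c (Suc k) = a k"
      using Suc.IH[OF a(1)] by blast
    have "(\<lambda>k. c (Suc k) - a k) \<in> range (ghost p)"
      by (intro ghost_range_diff[OF p] ghost_range_shift[OF p] a c)
    then obtain e where "c (Suc n) - a n = of_nat p ^ n * e"
      using ghost_range_leading[OF p_pos tf, of "\<lambda>k. c (Suc k) - a k" n] c(2) by auto
    moreover have "a n = of_nat p ^ m * b"
      using a(2)[of m] n ghost_single_comp_top[OF p_pos] by simp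
    ultimately have cn: "c (Suc n) = of_nat p ^ m * b + of_nat p ^ n * e"
      by (simp add: algebra_simps)
    obtain s where s: "\<tau> (Suc n) = of_nat p * (1 + of_nat p * s)"
      using tau(3)[of "Suc n"] n by auto
    \<comment> \<open>Chosen so that \<open>\<tau> (Suc n) * c (Suc n)\<close> equals p^n b +
      p^(n+1) t. The factor \<open>\<tau>\<close> supplies the missing p; subtracting V^(n+1) [t]
      removes the excess.\<close>
    define t where "t = e + s * b + of_nat p * s * e"
    let ?h = "\<lambda>k. \<tau> k * c k - ghost p (single_comp (Suc n) t) k"
    have "?h \<in> range (ghost p)"
      by (intro ghost_range_diff[OF p] ghost_range_mult[OF p] tau c rangeI)
    moreover have "?h (Suc k) = 0" if "k < n" for k
    proof -
      \<comment> \<open>At k = 0 the unknown c(1) is killed by \<open>\<tau> 1 = 0\<close>; for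
        larger k already c vanishes.\<close>
      have "\<tau> (Suc k) * c (Suc k) = 0"
      proof (cases k)
        case (Suc k')
        then have "c (Suc k) = ghost p (single_comp m b) k'"
          using that a(2)[of k'] c(2)[of k] by simp
        then show ?thesis
          using that n Suc by (simp add: ghost_single_comp_below[OF p_pos])
      qed (use tau(2) in simp)
      then show ?thesis
        using that by (simp add: ghost_single_comp_below[OF p_pos])
    qed
    moreover have "?h (Suc n) = of_nat p ^ n * b"
      unfolding s cn t_def ghost_single_comp_top[OF p_pos] by (simp add: n algebra_simps)
    ultimately show ?thesis
      by (intro bexI[of _ ?h]) simp_all
  qed
  obtain h where h: "h \<in> range (ghost p)" "\<And>k. k < n \<Longrightarrow> h (Suc k) = g k"
    using Suc.IH[OF Suc.prems] by blast
  have "(\<lambda>k. g k - h (Suc k)) \<in> range (ghost p)"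
    by (intro ghost_range_diff[OF p] ghost_range_shift[OF p] h Suc.prems)
  then obtain b where "g n - h (Suc n) = of_nat p ^ n * b"
    using ghost_range_leading[OF p_pos tf, of "\<lambda>k. g k - h (Suc k)" n] h(2) by auto
  moreover obtain h' where h': "h' \<in> range (ghost p)" "\<And>k. k < n \<Longrightarrow> h' (Suc k) = 0" "h' (Suc n) = of_nat p ^ n * b"
    using top[of b] by blast
  ultimately have "h (Suc k) + h' (Suc k) = g k" if "k < Suc n" for k
    using that h(2) by (cases "k = n") (auto simp: algebra_simps)
  then show ?case
    by (intro bexI[OF _ ghost_range_add[OF p h(1) h'(1)]]) simp
qed

section \<open>Witt-perfect rings\<close>

text \<open>Only x_0, ..., x_(k+1) occur, and k + 1 is at most n, so the truncation is
  invisible.\<close>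

lemma ghost_witt_frobenius:
  assumes "prime p" and "k < n"
  shows "ghost p (witt_frobenius p n (\<lambda>j. if j \<le> n then x j else 0)) k = ghost p x (Suc k)"
proof -
  let ?x = "\<lambda>j. if j \<le> n then x j else 0"
  have "ghost p (witt_frobenius p n ?x) k = ghost p (\<lambda>i. zpoly_eval ?x (witt_frob_poly p i)) k"
    using assms(2) by (intro ghost_cong) (simp add: witt_frobenius_def)
  also have "\<dots> = ghost p ?x (Suc k)"
    by (rule ghost_witt_frob_poly[OF assms(1)])
  also have "\<dots> = ghost p x (Suc k)"
    using assms(2) by (intro ghost_cong) simp
  finally show ?thesis .
qed

lemma witt_perfectD_ghost:
  fixes y :: "nat \<Rightarrow> 'a::comm_ring_1"
  assumes "prime p" and "witt_perfect p TYPE('a)" and "n \<ge> 2"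
  obtains x where "\<And>k. k < n \<Longrightarrow> ghost p x (Suc k) = ghost p y k"
proof -
  obtain x where x: "\<And>i. i < n \<Longrightarrow> witt_frobenius p n (\<lambda>j. if j \<le> n then x j else 0) i = y i"
    using assms(2,3) unfolding witt_perfect_def by blast
  have "ghost p x (Suc k) = ghost p y k" if "k < n" for k
  proof -
    have "ghost p y k = ghost p (witt_frobenius p n (\<lambda>j. if j \<le> n then x j else 0)) k"
      using that x by (intro ghost_cong) simp
    then show ?thesis
      by (simp add: ghost_witt_frobenius[OF assms(1) that])
  qed
  then show thesis by (rule that)
qed

text \<open>Returns from ghost components to Witt components, which is where torsion-freeness
  enters.\<close>

lemma witt_perfectI_ghost:
  assumes p: "prime p" and tf: "p_torsion_free p TYPE('b::comm_ring_1)"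
    and lift: "\<And>n (y :: nat \<Rightarrow> 'b). \<exists>x. \<forall>k<n. ghost p x (Suc k) = ghost p y k"
  shows "witt_perfect p TYPE('b)"
  unfolding witt_perfect_def
proof (intro allI impI)
  fix n and y :: "nat \<Rightarrow> 'b"
  obtain x where x: "\<And>k. k < n \<Longrightarrow> ghost p x (Suc k) = ghost p y k"
    using lift by blast
  have "witt_frobenius p n (\<lambda>j. if j \<le> n then x j else 0) i = y i" if "i < n" for i
    using ghost_inj_upto[OF tf _ that] by (simp add: ghost_witt_frobenius[OF p] x)
  then show "\<exists>x. \<forall>i<n. witt_frobenius p n (\<lambda>j. if j \<le> n then x j else 0) i = y i"
    by blast
qed

text \<open>The map f is the structure map of the algebra; surjectivity of Frobenius on B/pB is
  expressed through representatives in B.\<close>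

theorem mainTheorem3:
  fixes p :: nat and f :: "'a::comm_ring_1 \<Rightarrow> 'b::comm_ring_1"
  assumes "prime p"
    and "witt_perfect p TYPE('a)"
    and "f 1 = 1" and "\<And>x y. f (x + y) = f x + f y" and "\<And>x y. f (x * y) = f x * f y"
    and "p_torsion_free p TYPE('b)"
  shows "witt_perfect p TYPE('b) \<longleftrightarrow>
           (\<forall>b :: 'b. \<exists>c d :: 'b. b = c ^ p + of_nat p * d)"
proof
  assume wp: "witt_perfect p TYPE('b)"
  show "\<forall>b :: 'b. \<exists>c d :: 'b. b = c ^ p + of_nat p * d"
  proof
    fix b :: 'b
    \<comment> \<open>Length parameter 2 is the least one that \<open>witt_perfect\<close> provides;
      ghost component 1 already gives the representation of b.\<close>
    obtain x :: "nat \<Rightarrow> 'b" where "\<And>k. k < 2 \<Longrightarrow> ghost p x (Suc k) = ghost p (\<lambda>_. b) k"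
      using witt_perfectD_ghost[OF assms(1) wp, of 2 "\<lambda>_. b"] by auto
    from this[of 0] show "\<exists>c d :: 'b. b = c ^ p + of_nat p * d"
      by (auto simp: ghost_def)
  qed
next
  assume frob: "\<forall>b :: 'b. \<exists>c d :: 'b. b = c ^ p + of_nat p * d"
  note p_pos = prime_gt_0_nat[OF assms(1)]
  interpret f: comm_ring_hom f
    by unfold_locales (fact assms)+
  \<comment> \<open>A preimage of (0, 1) under Frobenius: its ghost components 1 and 2 are 0 and
    p.\<close>
  obtain x' :: "nat \<Rightarrow> 'a" where x': "\<And>k. k < 2 \<Longrightarrow> ghost p x' (Suc k) = ghost p (single_comp 1 1) k"
    using witt_perfectD_ghost[OF assms(1,2), of 2 "single_comp 1 1"] by auto
  define x where "x = (\<lambda>i. f (x' i))"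
  have "ghost p x 1 = f (ghost p x' (Suc 0))"
    by (simp add: f.hom_ghost x_def)
  then have x1: "x 0 ^ p = - (of_nat p * x 1)"
    by (simp add: x' ghost_single_comp_below p_pos f.hom_zero)
      (simp add: ghost_def add_eq_0_iff2)
  have "ghost p x' (Suc 1) = of_nat p"
    by (subst x') (simp_all add: ghost_single_comp_top[OF p_pos] del: One_nat_def)
  then have "ghost p x 2 = of_nat p"
    using f.hom_ghost[of p x' 2] by (simp add: x_def numeral_2_eq_2 f.hom_of_nat)
  then have x2: "(x 0 ^ p) ^ p + of_nat p * x 1 ^ p + of_nat p ^ 2 * x 2 = of_nat p"
    by (simp add: ghost_def numeral_2_eq_2 flip: power_mult)
  have xp: "\<exists>u. (x 0 ^ p) ^ q = of_nat p ^ 2 * u" if "q \<ge> 2" for q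
  proof -
    have "of_nat p ^ 2 dvd of_nat p ^ q * (- x 1) ^ q"
      using that by (intro dvd_mult2 le_imp_power_dvd)
    then show ?thesis
      unfolding x1 dvd_def by (simp flip: power_mult_distrib)
  qed
  obtain u where u: "(x 0 ^ p) ^ p = of_nat p ^ 2 * u"
    using xp prime_ge_2_nat[OF assms(1)] by blast
  \<comment> \<open>Since \<open>x 0 ^ p\<close> is a multiple of p, its p-th power is one of p^2;
    dividing the equation for ghost component 2 by p leaves x_1^p = 1 modulo p.\<close>
  have "of_nat p ^ 1 * (x 1 ^ p) = of_nat p ^ 1 * (1 - of_nat p * (u + x 2))"
    using x2 unfolding u by (simp add: algebra_simps power2_eq_square)
  then have "x 1 ^ p = 1 - of_nat p * (u + x 2)"
    by (rule p_torsion_free_power_cancel[OF assms(6)])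
  then have x1p: "of_nat p dvd x 1 ^ p - 1"
    by simp
  \<comment> \<open>Cutting off after x_1 leaves two terms in each later ghost component: a power of
    x_0 divisible by p^2, and p times a power of x_1 congruent to 1 modulo p.\<close>
  let ?tau = "ghost p (\<lambda>i. if i \<le> 1 then x i else 0)"
  have tau: "\<exists>s. ?tau m = of_nat p * (1 + of_nat p * s)" if "m \<ge> 2" for m
  proof -
    obtain k where m: "m = Suc (Suc k)"
      using le_Suc_ex[OF \<open>m \<ge> 2\<close>] by auto
    have "p ^ Suc k \<ge> 2"
      using prime_ge_2_nat[OF assms(1)] self_le_power[of p "Suc k"] p_pos by linarith
    then obtain v where v: "(x 0 ^ p) ^ (p ^ Suc k) = of_nat p ^ 2 * v"
      using xp by blast
    have "of_nat p dvd (x 1 ^ p) ^ (p ^ k) - 1 ^ (p ^ k)"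
      by (rule dvd_diff_power_power[OF x1p])
    then obtain w where "(x 1 ^ p) ^ (p ^ k) - 1 = of_nat p * w"
      by (auto simp: dvd_def)
    then have w: "x 1 ^ (p ^ Suc k) = 1 + of_nat p * w"
      by (simp add: algebra_simps flip: power_mult)
    have "?tau m = (\<Sum>i\<in>{0, 1}. of_nat p ^ i * x i ^ (p ^ (m - i)))"
      unfolding ghost_def using p_pos
      by (intro sum.mono_neutral_cong_right) (auto simp: m power_0_left)
    also have "\<dots> = (x 0 ^ p) ^ (p ^ Suc k) + of_nat p * x 1 ^ (p ^ Suc k)"
      by (simp add: m flip: power_mult)
    also have "\<dots> = of_nat p * (1 + of_nat p * (v + w))"
      unfolding v w by (simp add: algebra_simps power2_eq_square)
    finally show ?thesis ..
  qed
  have tau1: "?tau 1 = 0"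
    by (simp add: ghost_def x1)
  show "witt_perfect p TYPE('b)"
  proof (rule witt_perfectI_ghost[OF assms(1,6)])
    fix n and y :: "nat \<Rightarrow> 'b"
    have "\<exists>h\<in>range (ghost p). \<forall>k<n. h (Suc k) = ghost p y k"
      by (rule ghost_frobenius_surj[OF assms(1,6) spec[OF frob] rangeI tau1 tau]) auto
    then show "\<exists>x. \<forall>k<n. ghost p x (Suc k) = ghost p y k"
      by blast
  qed
qed

end
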